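(* Let $H:\mathbb N\to\mathbb N$ be defined by $H(0)=0$ and $H(i)=i-H(H(H(i-1)))$ for $i\ge1$. Let $(A(n))_{n\ge1}$ be the increasing enumeration of the natural numbers that occur exactly twice among the values $H(0),H(1),H(2),\dots$ (so $A=1,4,5,7,10,\dots$), and let $(B(n))_{n\ge1}$ be the increasing enumeration of the positive integers whose Narayana representation ends in the digit $1$ (so $B=1,5,7,10,14,\dots$). Then $A(n)+n-1=B(n)$ for all $n\ge1$.
   Context: The Narayana numbers are defined by $N_0=1$, $N_1=2$, $N_2=3$, $N_i=N_{i-1}+N_{i-3}$ for $i\ge3$. The Narayana representation of a positive integer $m$ is the unique binary word $e_1\cdots e_t$ with $e_1=1$, no factor $11$ or $101$, and $m=\sum_{i=1}^t e_iN_{t-i}$. *)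

theory Defs
  imports "HOL-Library.Infinite_Set" "HOL-Library.Sublist"
begin

function (domintros) H :: "nat \<Rightarrow> nat" where
  "H 0 = 0"
| "H (Suc i) = Suc i - H (H (H i))"
  by pat_completeness auto

lemma H_dom_le: "H_dom n \<Longrightarrow> H n \<le> n"
  by (induction rule: H.pinduct) (simp_all add: H.psimps)

termination
proof (relation "measure id")
  fix i assume "H_dom i"
  then show "(H i, Suc i) \<in> measure id"
    using H_dom_le[of i] by simp
next
  fix i assume i: "H_dom i" and Hi: "H_dom (H i)"
  then show "(H (H i), Suc i) \<in> measure id"
    using H_dom_le[OF i] H_dom_le[OF Hi] by simp
qed auto

lemma H_le: "H n \<le> n"
  by (induction n) simp_all

text \<open>The subtraction in the recursion is never truncated.\<close>

lemma H_rec: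
  assumes "i \<ge> 1"
  shows "int (H i) = int i - int (H (H (H (i - 1))))"
proof -
  obtain j where i: "i = Suc j" using assms by (cases i) auto
  have "H (H (H j)) \<le> j"
    using H_le[of j] H_le[of "H j"] H_le[of "H (H j)"] by linarith
  then show ?thesis by (simp add: i)
qed

fun narayana :: "nat \<Rightarrow> nat" where
  "narayana 0 = 1"
| "narayana (Suc 0) = 2"
| "narayana (Suc (Suc 0)) = 3"
| "narayana (Suc (Suc (Suc i))) = narayana (Suc (Suc i)) + narayana i"

text \<open>Words are lists of digits, most significant digit first; the digit called $e_i$ in the
  literature is \<open>w ! (i - 1)\<close>. Factors are contiguous subwords.\<close>

definition is_narayana_rep :: "nat \<Rightarrow> nat list \<Rightarrow> bool" where
  "is_narayana_rep m w \<longleftrightarrow>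
     w \<noteq> [] \<and> set w \<subseteq> {0, 1} \<and> hd w = 1 \<and>
     \<not> sublist [1, 1] w \<and> \<not> sublist [1, 0, 1] w \<and>
     m = (\<Sum>i = 1..length w. w ! (i - 1) * narayana (length w - i))"

definition narayana_rep :: "nat \<Rightarrow> nat list" where
  "narayana_rep m = (THE w. is_narayana_rep m w)"

text \<open>Library enumerations start at index 0, the sequences below at index 1.\<close>

definition A :: "nat \<Rightarrow> nat" where
  "A n = enumerate {k. card {i. H i = k} = 2} (n - 1)"

definition B :: "nat \<Rightarrow> nat" where
  "B n = enumerate {m. m > 0 \<and> last (narayana_rep m) = 1} (n - 1)"

end

theory Submission imports Defs begin

text \<open>
  \<open>H\<close> increases by \<open>0\<close> or \<open>1\<close> at each step, so \<open>i - H i\<close> counts the indices \<open>j < i\<close> with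
  \<open>H (j + 1) = H j\<close>. The values taken twice are the \<open>H i\<close> for such indices \<open>i\<close>; if \<open>i\<close> is the
  \<open>n\<close>-th one, then \<open>A n = H i = i - (n - 1)\<close>. It remains to see that these \<open>i\<close> are
  the numbers whose Narayana representation ends in \<open>1\<close>. This follows, digit by digit, from the
  shift identity \<open>H (N\<^sub>k + r) = N\<^sub>k\<^sub>-\<^sub>1 + H r\<close> for \<open>0 \<le> r \<le> N\<^sub>k\<^sub>-\<^sub>2\<close>.
\<close>

section \<open>Enumerations of infinite sets\<close>

lemma enumerate_range:
  fixes f :: "nat \<Rightarrow> 'a::wellorder"
  assumes "strict_mono f"
  shows "enumerate (range f) n = f n"
proof (induction n)
  case 0
  show ?case
    unfolding enumerate_0
    by (rule Least_equality) (auto simp: strict_mono_less_eq[OF assms])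
next
  case (Suc n)
  have "infinite (range f)"
    using strict_mono_imp_inj_on[OF assms] by (rule range_inj_infinite)
  then have "enumerate (range f) (Suc n) = (LEAST s. s \<in> range f \<and> f n < s)"
    by (simp add: enumerate_Suc'' Suc)
  also have "\<dots> = f (Suc n)"
    by (rule Least_equality)
      (auto simp: strict_mono_less[OF assms] strict_mono_less_eq[OF assms])
  finally show ?case .
qed

lemma enumerate_image:
  fixes S :: "nat set" and f :: "nat \<Rightarrow> 'a::wellorder"
  assumes "infinite S" "strict_mono_on S f"
  shows "enumerate (f ` S) n = f (enumerate S n)"
proof -
  have "strict_mono (f \<circ> enumerate S)"
    using assms by (intro strict_monoI) (simp add: strict_mono_onD enumerate_in_set)
  moreover have "range (f \<circ> enumerate S) = f ` S"
    using range_enumerate[OF assms(1)] by (simp only: image_comp [symmetric])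
  ultimately show ?thesis
    using enumerate_range[of "f \<circ> enumerate S" n] by simp
qed

lemma card_less_enumerate:
  fixes S :: "nat set"
  assumes "infinite S"
  shows "card {s \<in> S. s < enumerate S n} = n"
proof -
  have "{s \<in> S. s < enumerate S n} = {s \<in> range (enumerate S). s < enumerate S n}"
    by (simp only: range_enumerate[OF assms])
  also have "\<dots> = enumerate S ` {..<n}"
    using assms by auto
  finally show ?thesis
    using inj_on_subset[OF inj_enumerate[OF assms]] by (simp add: card_image)
qed

section \<open>Sequences with isolated repetitions\<close>

definition repeats :: "(nat \<Rightarrow> 'a) \<Rightarrow> nat set" where
  "repeats f = {i. f (Suc i) = f i}"

lemma mem_repeats_iff: "i \<in> repeats f \<longleftrightarrow> f (Suc i) = f i"
  by (simp add: repeats_def)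

lemma mono_eq_imp_mem_repeats:
  fixes f :: "nat \<Rightarrow> 'a::order"
  assumes "mono f" "i < j" "f i = f j"
  shows "i \<in> repeats f"
  using monoD[OF assms(1), of i "Suc i"] monoD[OF assms(1), of "Suc i" j] assms(2,3)
  by (simp add: mem_repeats_iff)

lemma mono_eq_imp_le_Suc:
  fixes f :: "nat \<Rightarrow> 'a::order"
  assumes "mono f" "\<forall>i \<in> repeats f. Suc i \<notin> repeats f" "f i = f j"
  shows "j \<le> Suc i"
proof (rule ccontr)
  assume "\<not> j \<le> Suc i"
  then have "i < j" "Suc i < j" by simp_all
  have "i \<in> repeats f"
    using assms(1) \<open>i < j\<close> assms(3) by (rule mono_eq_imp_mem_repeats)
  moreover from this have "f (Suc i) = f j"
    using assms(3) by (simp add: mem_repeats_iff)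
  with assms(1) \<open>Suc i < j\<close> have "Suc i \<in> repeats f"
    by (rule mono_eq_imp_mem_repeats)
  ultimately show False using assms(2) by blast
qed

lemma strict_mono_on_repeats:
  fixes f :: "nat \<Rightarrow> 'a::order"
  assumes "mono f" "\<forall>i \<in> repeats f. Suc i \<notin> repeats f"
  shows "strict_mono_on (repeats f) f"
proof (rule strict_mono_onI)
  fix i j assume "j \<in> repeats f" "i < j"
  have "f i \<noteq> f j"
    using mono_eq_imp_le_Suc[OF assms, of i "Suc j"] \<open>j \<in> repeats f\<close> \<open>i < j\<close>
    by (auto simp: mem_repeats_iff)
  then show "f i < f j"
    using monoD[OF assms(1), of i j] \<open>i < j\<close> by simp
qed

lemma fibre_repeats:
  fixes f :: "nat \<Rightarrow> 'a::order"
  assumes "mono f" "\<forall>i \<in> repeats f. Suc i \<notin> repeats f" "i \<in> repeats f"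
  shows "{j. f j = f i} = {i, Suc i}"
proof -
  have "j = i \<or> j = Suc i" if "f j = f i" for j
    using mono_eq_imp_le_Suc[OF assms(1,2), of i j] mono_eq_imp_le_Suc[OF assms(1,2), of j "Suc i"]
      that assms(3) by (auto simp: mem_repeats_iff)
  then show ?thesis
    using assms(3) by (auto simp: mem_repeats_iff)
qed

lemma card_fibre_2_eq_image_repeats:
  fixes f :: "nat \<Rightarrow> 'a::order"
  assumes "mono f" "\<forall>i \<in> repeats f. Suc i \<notin> repeats f"
  shows "{y. card {i. f i = y} = 2} = f ` repeats f"
proof (intro equalityI subsetI)
  fix y assume "y \<in> {y. card {i. f i = y} = 2}"
  then obtain a b where "f a = y" "f b = y" "a \<noteq> b"
    by (auto simp: card_2_iff')
  then have "a \<in> repeats f \<or> b \<in> repeats f"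
    using mono_eq_imp_mem_repeats[OF assms(1), of a b] mono_eq_imp_mem_repeats[OF assms(1), of b a]
    by (auto simp: neq_iff)
  then show "y \<in> f ` repeats f"
    using \<open>f a = y\<close> \<open>f b = y\<close> by (metis imageI)
next
  fix y assume "y \<in> f ` repeats f"
  then obtain i where "i \<in> repeats f" "y = f i" by blast
  then show "y \<in> {y. card {i. f i = y} = 2}"
    using fibre_repeats[OF assms] by simp
qed

definition unit_steps :: "(nat \<Rightarrow> nat) \<Rightarrow> bool" where
  "unit_steps f \<longleftrightarrow> (\<forall>i. f (Suc i) = f i \<or> f (Suc i) = Suc (f i))"

lemma unit_steps_imp_mono:
  assumes "unit_steps f"
  shows "mono f"
  unfolding mono_iff_le_Suc
proof
  fix i show "f i \<le> f (Suc i)"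
    using assms unfolding unit_steps_def by (metis le_Suc_eq order_refl)
qed

lemma unit_steps_add_card_repeats:
  assumes "unit_steps f"
  shows "f i + card {j \<in> repeats f. j < i} = f 0 + i"
proof (induction i)
  case (Suc i)
  have less_Suc: "{j \<in> repeats f. j < Suc i} =
    (if i \<in> repeats f then insert i {j \<in> repeats f. j < i} else {j \<in> repeats f. j < i})"
    by (auto simp: less_Suc_eq)
  have "f (Suc i) = (if i \<in> repeats f then f i else Suc (f i))"
    using assms unfolding unit_steps_def mem_repeats_iff by metis
  with Suc less_Suc show ?case by simp
qed simp

lemma enumerate_card_fibre_2_add:
  assumes "unit_steps f" "\<forall>i \<in> repeats f. Suc i \<notin> repeats f" "infinite (repeats f)"
  shows "enumerate {y. card {i. f i = y} = 2} n + n = f 0 + enumerate (repeats f) n"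
proof -
  have mono: "mono f"
    using assms(1) by (rule unit_steps_imp_mono)
  have "enumerate {y. card {i. f i = y} = 2} n = f (enumerate (repeats f) n)"
    using assms(3) strict_mono_on_repeats[OF mono assms(2)]
    unfolding card_fibre_2_eq_image_repeats[OF mono assms(2)] by (rule enumerate_image)
  then show ?thesis
    using unit_steps_add_card_repeats[OF assms(1), of "enumerate (repeats f) n"]
      card_less_enumerate[OF assms(3)] by simp
qed

section \<open>The function \<open>H\<close>\<close>

declare H.simps(2) [simp del]

lemma H_1: "H 1 = 1" and H_2: "H 2 = 1" and H_3: "H 3 = 2" and H_4: "H 4 = 3"
  by (simp_all add: numeral_eq_Suc H.simps(2))

lemma H_H_H_le: "H (H (H i)) \<le> i"
  using H_le[of i] H_le[of "H i"] H_le[of "H (H i)"] by linarith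

lemma unit_steps_H: "unit_steps H"
  unfolding unit_steps_def
proof
  fix i show "H (Suc i) = H i \<or> H (Suc i) = Suc (H i)"
  proof (induction i rule: less_induct)
    case (less i)
    show ?case
    proof (cases i)
      case 0
      then show ?thesis by (simp add: H.simps(2))
    next
      case (Suc j)
      have step: "H y = H x \<or> H y = Suc (H x)" if "y = x \<or> y = Suc x" "x \<le> j" for x y
        using that less.IH[of x] Suc by auto
      have "H j \<le> j" "H (H j) \<le> j"
        using H_le[of j] H_le[of "H j"] by linarith+
      then have "H (H (H i)) = H (H (H j)) \<or> H (H (H i)) = Suc (H (H (H j)))"
        using Suc by (intro step) simp_all
      then show ?thesis
        using H_H_H_le[of j] Suc H.simps(2)[of i] H.simps(2)[of j] by auto
    qed
  qed
qed

lemma Suc_notin_repeats_H: "\<forall>i \<in> repeats H. Suc i \<notin> repeats H"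
proof
  fix i assume "i \<in> repeats H"
  then have "H (Suc (Suc i)) = Suc (Suc i) - H (H (H i))"
    by (simp add: H.simps(2)[of "Suc i"] mem_repeats_iff)
  also have "\<dots> = Suc (H (Suc i))"
    using H_H_H_le[of i] by (simp add: H.simps(2)[of i] Suc_diff_le)
  finally show "Suc i \<notin> repeats H" by (simp add: mem_repeats_iff)
qed

lemma zero_notin_repeats_H: "0 \<notin> repeats H" and one_mem_repeats_H: "1 \<in> repeats H"
  using H_1 H_2 by (simp_all add: mem_repeats_iff numeral_2_eq_2)

section \<open>The shift identity\<close>

text \<open>A shift by \<open>a\<close> turns into shifts by \<open>b\<close>, \<open>c\<close> and \<open>d\<close> under one, two and three
  applications of \<open>H\<close>; the recursion of \<open>H\<close> then propagates it because \<open>a = b + d\<close>.\<close>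

lemma H_add_shift:
  assumes "H a = b" "a = b + d"
    and "\<And>s. s \<le> H q \<Longrightarrow> H (b + s) = c + H s"
    and "\<And>s. s \<le> H (H q) \<Longrightarrow> H (c + s) = d + H s"
    and "r \<le> q"
  shows "H (a + r) = b + H r"
  using assms(5)
proof (induction r)
  case 0
  then show ?case using assms(1) by simp
next
  case (Suc r)
  have mono: "mono H"
    using unit_steps_H by (rule unit_steps_imp_mono)
  have "H r \<le> H q" "H (H r) \<le> H (H q)"
    using Suc.prems by (auto intro!: monoD[OF mono])
  then have "H (H (H (a + r))) = d + H (H (H r))"
    using Suc assms(3,4) by simp
  then have "H (a + Suc r) = Suc (b + d + r) - (d + H (H (H r)))"
    by (simp add: H.simps(2) assms(2))
  also have "\<dots> = b + H (Suc r)"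
    using H_H_H_le[of r] by (simp add: H.simps(2))
  finally show ?case .
qed

lemma strict_mono_narayana: "strict_mono narayana"
  unfolding strict_mono_Suc_iff
proof
  fix k show "narayana k < narayana (Suc k)"
    by (induction k rule: narayana.induct) auto
qed

lemma le_narayana: "k \<le> narayana k"
  using strict_mono_narayana by (rule strict_mono_imp_increasing)

text \<open>For \<open>k = 0\<close> the truncated index \<open>k - 1 = 0\<close> gives the correct value
  \<open>N\<^sub>-\<^sub>1 = N\<^sub>2 - N\<^sub>1 = 1\<close>.\<close>

lemma H_narayana_Suc_add:
  "r \<le> narayana (k - 1) \<Longrightarrow> H (narayana (Suc k) + r) = narayana k + H r"
proof (induction k arbitrary: r rule: less_induct)
  case (less k)
  consider (zero) "k = 0" | (one) "k = 1" | (Suc_Suc) l where "k = Suc (Suc l)"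
    by (metis One_nat_def not0_implies_Suc)
  then show ?case
  proof cases
    case zero
    with less.prems have "r = 0 \<or> r = 1" by auto
    then show ?thesis using zero H_1 H_2 H_3 by (auto simp: numeral_eq_Suc)
  next
    case one
    with less.prems have "r = 0 \<or> r = 1" by auto
    then show ?thesis using one H_1 H_3 H_4 by (auto simp: numeral_eq_Suc)
  next
    case (Suc_Suc l)
    have H_narayana: "H (narayana j) = narayana (j - 1)" if "j \<le> k" for j
      using that less.IH[of "j - 1" 0] H_1 by (cases j) simp_all
    have "H (narayana (Suc k)) = H (narayana (Suc (Suc l)) + narayana l)"
      by (simp add: Suc_Suc)
    also have "\<dots> = narayana (Suc l) + narayana (l - 1)"
      using less.IH[of "Suc l" "narayana l"] H_narayana[of l] Suc_Suc by simp
    also have "\<dots> = narayana k"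
      by (cases l) (simp_all add: Suc_Suc)
    finally have "H (narayana (Suc k)) = narayana k" .
    then show ?thesis
    proof (rule H_add_shift)
      show "narayana (Suc k) = narayana k + narayana l" by (simp add: Suc_Suc)
      show "r \<le> narayana (Suc l)" using less.prems Suc_Suc by simp
      show "H (narayana k + s) = narayana (Suc l) + H s" if "s \<le> H (narayana (Suc l))" for s
        using that less.IH[of "Suc l" s] H_narayana[of "Suc l"] Suc_Suc by simp
      show "H (narayana (Suc l) + s) = narayana l + H s" if "s \<le> H (H (narayana (Suc l)))" for s
        using that less.IH[of l s] H_narayana[of "Suc l"] H_narayana[of l] Suc_Suc by simp
    qed
  qed
qed

lemma narayana_Suc_add_mem_repeats_H_iff:
  assumes "r < narayana (k - 1)"
  shows "narayana (Suc k) + r \<in> repeats H \<longleftrightarrow> r \<in> repeats H"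
  using H_narayana_Suc_add[of r k] H_narayana_Suc_add[of "Suc r" k] assms
  by (simp add: mem_repeats_iff)

lemma infinite_repeats_H: "infinite (repeats H)"
  unfolding infinite_nat_iff_unbounded_le
proof
  fix m :: nat
  have "1 < narayana (Suc (Suc m))"
    using le_narayana[of "Suc (Suc m)"] by simp
  then have "narayana (m + 4) + 1 \<in> repeats H"
    using narayana_Suc_add_mem_repeats_H_iff[of 1 "m + 3"] one_mem_repeats_H
    by (simp add: numeral_eq_Suc)
  moreover have "m \<le> narayana (m + 4) + 1"
    using le_narayana[of "m + 4"] by simp
  ultimately show "\<exists>n\<ge>m. n \<in> repeats H" by blast
qed

section \<open>Narayana representations\<close>

fun narayana_val :: "nat list \<Rightarrow> nat" where
  "narayana_val [] = 0"
| "narayana_val (e # w) = e * narayana (length w) + narayana_val w"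

lemma narayana_val_eq_sum:
  "narayana_val w = (\<Sum>i = 1..length w. w ! (i - 1) * narayana (length w - i))"
proof (induction w)
  case (Cons e w)
  have "(\<Sum>i = 1..length (e # w). (e # w) ! (i - 1) * narayana (length (e # w) - i)) =
    (\<Sum>i = 0..length w. (e # w) ! i * narayana (length w - i))"
    using sum.shift_bounds_cl_Suc_ivl[of
        "\<lambda>i. (e # w) ! (i - 1) * narayana (length (e # w) - i)" 0 "length w"]
    by simp
  also have "\<dots> = e * narayana (length w) +
    (\<Sum>i = 1..length w. w ! (i - 1) * narayana (length w - i))"
    by (simp add: sum.atLeast_Suc_atMost)
  finally show ?case using Cons by simp
qed simp

inductive narayana_word :: "nat list \<Rightarrow> bool" where
  Nil: "narayana_word []"
| zero: "narayana_word w \<Longrightarrow> narayana_word (0 # w)"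
| one: "narayana_word [1]"
| one_zero: "narayana_word [1, 0]"
| one_zero_zero: "narayana_word w \<Longrightarrow> narayana_word (1 # 0 # 0 # w)"

declare narayana_word.intros [simplified, intro]

lemma factor_free_imp_narayana_word:
  assumes "set w \<subseteq> {0, 1}" "\<not> sublist [1, 1] w" "\<not> sublist [1, 0, 1] w"
  shows "narayana_word w"
  using assms
proof (induction w rule: measure_induct_rule[of length])
  case (less w)
  consider "w = []" | v where "w = 0 # v" | "w = [1]" | "w = [1, 0]" | v where "w = 1 # 0 # 0 # v"
  proof (cases w)
    case (Cons a u)
    show thesis
    proof (cases "a = 0")
      case False
      then have "a = 1" using less.prems(1) Cons by simp
      moreover from this have "u = [] \<or> u = [0] \<or> (\<exists>v. u = 0 # 0 # v)"
        using less.prems Cons by (cases u; cases "tl u") (auto simp: sublist_Cons_right)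
      ultimately show thesis using that Cons by blast
    qed (use that Cons in blast)
  qed (use that in blast)
  then show ?case
    using less by cases (auto simp: sublist_Cons_right)
qed

lemma narayana_word_iff:
  "narayana_word w \<longleftrightarrow> set w \<subseteq> {0, 1} \<and> \<not> sublist [1, 1] w \<and> \<not> sublist [1, 0, 1] w"
proof
  show "narayana_word w \<Longrightarrow> set w \<subseteq> {0, 1} \<and> \<not> sublist [1, 1] w \<and> \<not> sublist [1, 0, 1] w"
    by (induction rule: narayana_word.induct) (auto simp: sublist_Cons_right)
qed (simp add: factor_free_imp_narayana_word)

lemma narayana_word_ConsD:
  "narayana_word (e # w) \<Longrightarrow> (e = 0 \<or> e = 1) \<and> narayana_word w"
  by (auto simp: narayana_word_iff sublist_Cons_right)

lemma is_narayana_rep_iff: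
  "is_narayana_rep m w \<longleftrightarrow> w \<noteq> [] \<and> hd w = 1 \<and> narayana_word w \<and> m = narayana_val w"
  unfolding is_narayana_rep_def narayana_word_iff narayana_val_eq_sum by auto

lemma narayana_val_less: "narayana_word w \<Longrightarrow> narayana_val w < narayana (length w)"
proof (induction rule: narayana_word.induct)
  case (zero w)
  have "narayana (length w) < narayana (length (0 # w))"
    by (simp add: strict_mono_less[OF strict_mono_narayana])
  with zero.IH show ?case by simp
qed auto

lemma narayana_val_eq_imp_eq:
  assumes "narayana_word u" "narayana_word v" "length u = length v" "narayana_val u = narayana_val v"
  shows "u = v"
  using assms(3,1,2,4)
proof (induction u v rule: list_induct2)
  case (Cons d u e v)
  then have words: "narayana_word u" "narayana_word v" and "d = 0 \<or> d = 1" "e = 0 \<or> e = 1"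
    using narayana_word_ConsD by blast+
  then have "d = e"
    using Cons.hyps Cons.prems narayana_val_less[OF words(1)] narayana_val_less[OF words(2)]
    by auto
  then show ?case
    using Cons words by simp
qed simp

lemma is_narayana_rep_length_le:
  assumes "is_narayana_rep m u" "is_narayana_rep m v"
  shows "length u \<le> length v"
proof -
  have "narayana (length u - 1) \<le> m"
    using assms(1) by (cases u) (auto simp: is_narayana_rep_iff)
  also have "m < narayana (length v)"
    using assms(2) narayana_val_less by (simp add: is_narayana_rep_iff)
  finally have "length u - 1 < length v"
    by (simp add: strict_mono_less[OF strict_mono_narayana])
  then show ?thesis by simp
qed

lemma is_narayana_rep_unique:
  assumes "is_narayana_rep m u" "is_narayana_rep m v"
  shows "u = v"
proof -
  have "length u = length v"
    using assms by (intro order_antisym is_narayana_rep_length_le)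
  then show ?thesis
    using assms by (auto simp: is_narayana_rep_iff intro: narayana_val_eq_imp_eq)
qed

lemma narayana_word_exists:
  "m < narayana t \<Longrightarrow> \<exists>w. narayana_word w \<and> length w = t \<and> narayana_val w = m"
proof (induction t arbitrary: m rule: narayana.induct)
  case 1
  then show ?case by auto
next
  case 2
  then have "m = 0 \<or> m = 1" by auto
  then show ?case
    by (intro exI[of _ "[m]"]) auto
next
  case 3
  then have "m = 0 \<or> m = 1 \<or> m = 2" by auto
  then show ?case
    by (intro exI[of _ "if m = 2 then [1, 0] else [0, m]"]) auto
next
  case (4 t)
  show ?case
  proof (cases "m < narayana (Suc (Suc t))")
    case True
    then obtain w where "narayana_word w" "length w = Suc (Suc t)" "narayana_val w = m"
      using "4.IH"(1) by blast
    then show ?thesis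
      by (intro exI[of _ "0 # w"]) auto
  next
    case False
    then have "m - narayana (Suc (Suc t)) < narayana t"
      using "4.prems" by simp
    then obtain w where
      "narayana_word w" "length w = t" "narayana_val w = m - narayana (Suc (Suc t))"
      using "4.IH"(2) by blast
    then show ?thesis
      using False narayana_word.one_zero_zero[of w]
      by (intro exI[of _ "1 # 0 # 0 # w"]) simp
  qed
qed

lemma narayana_word_imp_is_narayana_rep:
  "narayana_word w \<Longrightarrow> narayana_val w > 0 \<Longrightarrow> \<exists>v. is_narayana_rep (narayana_val w) v"
proof (induction w)
  case (Cons e w)
  then consider (zero) "e = 0" "narayana_word w" | (one) "e = 1"
    using narayana_word_ConsD by blast
  then show ?case
  proof cases
    case zero
    then show ?thesis using Cons by simp
  next
    case one
    then have "is_narayana_rep (narayana_val (e # w)) (e # w)"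
      using Cons.prems by (simp add: is_narayana_rep_iff)
    then show ?thesis by blast
  qed
qed simp

lemma is_narayana_rep_narayana_rep:
  assumes "m > 0"
  shows "is_narayana_rep m (narayana_rep m)"
proof -
  have "m < narayana (Suc m)"
    using le_narayana[of "Suc m"] by simp
  then obtain w where "narayana_word w" "narayana_val w = m"
    using narayana_word_exists by blast
  then have "\<exists>v. is_narayana_rep m v"
    using narayana_word_imp_is_narayana_rep assms by blast
  then show ?thesis
    unfolding narayana_rep_def by (blast intro: theI' is_narayana_rep_unique)
qed

lemma last_narayana_word_iff:
  "narayana_word w \<Longrightarrow> w \<noteq> [] \<Longrightarrow> last w = 1 \<longleftrightarrow> narayana_val w \<in> repeats H"
proof (induction rule: narayana_word.induct)
  case (zero w)
  then show ?case by (cases "w = []") (auto simp: zero_notin_repeats_H)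
next
  case one
  show ?case using one_mem_repeats_H by simp
next
  case one_zero
  show ?case using Suc_notin_repeats_H one_mem_repeats_H by (auto simp: numeral_2_eq_2)
next
  case (one_zero_zero w)
  have "narayana_val (1 # 0 # 0 # w) \<in> repeats H \<longleftrightarrow> narayana_val w \<in> repeats H"
    using narayana_Suc_add_mem_repeats_H_iff[of "narayana_val w" "Suc (length w)"]
      narayana_val_less[OF one_zero_zero.hyps] by simp
  then show ?case
    using one_zero_zero by (cases "w = []") (auto simp: zero_notin_repeats_H)
qed simp

lemma pos_and_last_narayana_rep_iff:
  "m > 0 \<and> last (narayana_rep m) = 1 \<longleftrightarrow> m \<in> repeats H"
proof (cases "m = 0")
  case False
  then show ?thesis
    using is_narayana_rep_narayana_rep[of m] last_narayana_word_iff[of "narayana_rep m"]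
    by (simp add: is_narayana_rep_iff)
qed (simp add: zero_notin_repeats_H)

theorem theorem38:
  fixes n :: nat
  assumes "n \<ge> 1"
  shows "A n + n - 1 = B n"
proof -
  have "B n = enumerate (repeats H) (n - 1)"
    unfolding B_def pos_and_last_narayana_rep_iff by simp
  moreover have "A n + (n - 1) = H 0 + enumerate (repeats H) (n - 1)"
    unfolding A_def using unit_steps_H Suc_notin_repeats_H infinite_repeats_H
    by (rule enumerate_card_fibre_2_add)
  ultimately show ?thesis
    using assms by simp
qed

end
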